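(* Let $\xi\in\,]0,1[$. Let $p$ be the exact solution of the one-dimensional wave equation initial-boundary value problem on $\Omega=[x_{\min},x_{\max}]$ described in the context, with propagation velocity $c>0$ and initial data $p_0,p_1$, and suppose $p$ is sufficiently regular of order $4$ uniformly on $\Omega\times[0,t_{\max}]$. For discretization parameters $\Delta x,\Delta t$, let $p_{\mathrm h}$ be the solution of the second-order centered explicit finite difference scheme with inputs $u_{0,i}=p_0(x_i)$, $u_{1,i}=p_1(x_i)$, $s_{\mathrm h}\equiv 0$, and let $e_i^k=p(x_i,t^k)-p_i^k$ be the convergence error. If the discretization parameters satisfy the CFL$(\xi)$ condition, $\frac{c\,\Delta t}{\Delta x}\le 1-\xi$, then the scheme is convergent of order $(2,2)$ uniformly on $[0,t_{\max}]$, i.e. there exist constants $\alpha>0$ and $C>0$ such that for all $t\in[0,t_{\max}]$ and all discretization parameters $\Delta x,\Delta t>0$ satisfying CFL$(\xi)$ and $\sqrt{\Delta x^2+\Delta t^2}<\alpha$, $$\left\|e_{\mathrm h}^{k_{\Delta t}(t)}\right\|_{\Delta x}\le C\,(\Delta x^2+\Delta t^2).$$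
   Context: Continuous problem. $x_{\min}<x_{\max}$, $\Omega=[x_{\min},x_{\max}]$, $c>0$, $t_{\max}>0$. The exact solution $p(x,t)$ satisfies $\frac{\partial^2p}{\partial t^2}(x,t)-c^2\frac{\partial^2p}{\partial x^2}(x,t)=0$ for all $t\ge0$, $x\in\Omega$; $\frac{\partial p}{\partial t}(x,0)=p_1(x)$ and $p(x,0)=p_0(x)$ for $x\in\Omega$; and $p(x_{\min},t)=p(x_{\max},t)=0$ for $t\ge 0$. (A solution is assumed to exist. In the regularity notion below $p$ is regarded as a function on $\mathbb R^2$.) Grid. For integers $i_{\max},k_{\max}\ge1$: $\Delta x=\frac{x_{\max}-x_{\min}}{i_{\max}}$, $\Delta t=\frac{t_{\max}}{k_{\max}}$, $x_i=x_{\min}+i\Delta x$, $t^k=k\Delta t$, $k_{\Delta t}(t)=\lfloor t/\Delta t\rfloor$, for $0\le i\le i_{\max}$, $0\le k\le k_{\max}$. "Discretization parameters" are pairs $(\Delta x,\Delta t)$ of this form. Scheme. Given $u_{0,i},u_{1,i},s_i^k$, the discrete solution $p_{\mathrm h}=(p_i^k)$ is defined by: for $2\le k\le k_{\max}$, $1\le i\le i_{\max}-1$: $\frac{p_i^k-2p_i^{k-1}+p_i^{k-2}}{\Delta t^2}+(A_{\mathrm h}p_{\mathrm h}^{k-1})_i=s_i^{k-1}$; for $1\le i\le i_{\max}-1$: $\frac{p_i^1-p_i^0}{\Delta t}+\frac{\Delta t}{2}(A_{\mathrm h}p_{\mathrm h}^0)_i=u_{1,i}$ and $p_i^0=u_{0,i}$;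 for $0\le k\le k_{\max}$: $p_0^k=p_{i_{\max}}^k=0$; where $(A_{\mathrm h}q)_i=-c^2\frac{q_{i+1}-2q_i+q_{i-1}}{\Delta x^2}$. Norm. $\|q_{\mathrm h}\|_{\Delta x}^2=\sum_{i=1}^{i_{\max}-1}q_i^2\,\Delta x$. Regularity. For $f:\mathbb R^2\to\mathbb R$ and $\mathbf x\in\mathbb R^2$, the Taylor polynomial of order $n$ is $\mathrm{TP}_n(f,\mathbf x)(\Delta x,\Delta t)=\sum_{q=0}^n\frac1{q!}\sum_{m=0}^q\binom qm\frac{\partial^q f}{\partial x^m\partial t^{q-m}}(\mathbf x)\,\Delta x^m\Delta t^{q-m}$. It is a uniform approximation of order $n$ of $f$ on $\Omega_{\mathbf x}\subset\mathbb R^2$ if there exist $\alpha,C>0$ such that for all $\mathbf x\in\Omega_{\mathbf x}$ and all $\mathbf h\in\mathbb R^2$ with Euclidean norm $\|\mathbf h\|<\alpha$, $|f(\mathbf x+\mathbf h)-\mathrm{TP}_n(f,\mathbf x)(\mathbf h)|\le C\|\mathbf h\|^{n+1}$. The function $f$ is sufficiently regular of order $n$ uniformly on $\Omega_{\mathbf x}$ when all its Taylor polynomials of order smaller than $n$ are uniform approximations on $\Omega_{\mathbf x}$ (the partial derivatives involved being assumed to exist). *)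

theory Defs
  imports "HOL-Analysis.Analysis"
begin

text \<open>
  The plane is the type \<^typ>\<open>real \<times> real\<close>, whose library norm is the Euclidean one; points are
  written \<^term>\<open>(x, t)\<close>.
\<close>

text \<open>
  The equation is posed on the closed half-strip, so derivatives are taken within it: they are
  one-sided at \<open>t = 0\<close>, at \<open>xmin\<close> and at \<open>xmax\<close>. Where the two-sided derivatives of \<open>p\<close>, as a
  function on the plane, exist, they are the same.
\<close>

definition exact_solution ::
  "real \<Rightarrow> real \<Rightarrow> real \<Rightarrow> (real \<Rightarrow> real) \<Rightarrow> (real \<Rightarrow> real) \<Rightarrow> (real \<times> real \<Rightarrow> real) \<Rightarrow> bool" where
  "exact_solution xmin xmax c p0 p1 p \<longleftrightarrow>
    (\<exists>pt ptt px pxx :: real \<Rightarrow> real \<Rightarrow> real.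
      (\<forall>x\<in>{xmin..xmax}. \<forall>t\<ge>0.
          ((\<lambda>s. p (x, s)) has_real_derivative pt x t) (at t within {0..}) \<and>
          ((\<lambda>s. pt x s) has_real_derivative ptt x t) (at t within {0..}) \<and>
          ((\<lambda>y. p (y, t)) has_real_derivative px x t) (at x within {xmin..xmax}) \<and>
          ((\<lambda>y. px y t) has_real_derivative pxx x t) (at x within {xmin..xmax}) \<and>
          ptt x t - c\<^sup>2 * pxx x t = 0) \<and>
      (\<forall>x\<in>{xmin..xmax}. pt x 0 = p1 x \<and> p (x, 0) = p0 x) \<and>
      (\<forall>t\<ge>0. p (xmin, t) = 0 \<and> p (xmax, t) = 0))"

text \<open>
  As usual for \<open>\<partial>\<close>-notation, in a mixed derivative the \<open>k\<close> derivatives in \<open>t\<close> are taken before the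
  \<open>m\<close> derivatives in \<open>x\<close>.
\<close>

definition partial_deriv :: "nat \<Rightarrow> nat \<Rightarrow> (real \<times> real \<Rightarrow> real) \<Rightarrow> real \<times> real \<Rightarrow> real" where
  "partial_deriv m k f = (\<lambda>(x, t). (deriv ^^ m) (\<lambda>y. (deriv ^^ k) (\<lambda>s. f (y, s)) t) x)"

text \<open>
  \<^const>\<open>deriv\<close> has an unspecified value where the derivative does not exist, hence this predicate.
  Existence at a point requires the derivative of one order less to exist in a neighbourhood of that
  point along the line of differentiation, and to be differentiable at the point.
\<close>

fun partial_deriv_exists :: "nat \<Rightarrow> nat \<Rightarrow> (real \<times> real \<Rightarrow> real) \<Rightarrow> real \<times> real \<Rightarrow> bool" where
  "partial_deriv_exists 0 0 f (x, t) \<longleftrightarrow> True"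
| "partial_deriv_exists 0 (Suc k) f (x, t) \<longleftrightarrow>
     (\<forall>\<^sub>F s in nhds t. partial_deriv_exists 0 k f (x, s)) \<and>
     (\<lambda>s. partial_deriv 0 k f (x, s)) field_differentiable (at t)"
| "partial_deriv_exists (Suc m) k f (x, t) \<longleftrightarrow>
     (\<forall>\<^sub>F y in nhds x. partial_deriv_exists m k f (y, t)) \<and>
     (\<lambda>y. partial_deriv m k f (y, t)) field_differentiable (at x)"

definition taylor_poly :: "nat \<Rightarrow> (real \<times> real \<Rightarrow> real) \<Rightarrow> real \<times> real \<Rightarrow> real \<times> real \<Rightarrow> real" where
  "taylor_poly n f z = (\<lambda>(dx, dt).
     \<Sum>q=0..n. 1 / fact q *
       (\<Sum>m=0..q. real (q choose m) * partial_deriv m (q - m) f z * dx ^ m * dt ^ (q - m)))"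

definition taylor_uniform_approx :: "nat \<Rightarrow> (real \<times> real \<Rightarrow> real) \<Rightarrow> (real \<times> real) set \<Rightarrow> bool" where
  "taylor_uniform_approx n f S \<longleftrightarrow>
     (\<exists>\<alpha>>0. \<exists>C>0. \<forall>z\<in>S. \<forall>h. norm h < \<alpha> \<longrightarrow>
        \<bar>f (z + h) - taylor_poly n f z h\<bar> \<le> C * norm h ^ (n + 1))"

definition sufficiently_regular :: "nat \<Rightarrow> (real \<times> real \<Rightarrow> real) \<Rightarrow> (real \<times> real) set \<Rightarrow> bool" where
  "sufficiently_regular n f S \<longleftrightarrow>
     (\<forall>j<n. (\<forall>z\<in>S. \<forall>q\<le>j. \<forall>m\<le>q. partial_deriv_exists m (q - m) f z) \<and>
            taylor_uniform_approx j f S)"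

text \<open>
  A discrete function \<open>ph\<close> is written with the time index first: \<open>ph k i\<close> approximates
  \<open>p (x\<^sub>i, t\<^sup>k)\<close>. Index subtractions on \<^typ>\<open>nat\<close> never truncate in the ranges where they are used.
\<close>

definition discretization ::
  "real \<Rightarrow> real \<Rightarrow> real \<Rightarrow> nat \<Rightarrow> nat \<Rightarrow> real \<Rightarrow> real \<Rightarrow> bool" where
  "discretization xmin xmax tmax imax kmax dx dt \<longleftrightarrow>
     imax \<ge> 1 \<and> kmax \<ge> 1 \<and> dx = (xmax - xmin) / real imax \<and> dt = tmax / real kmax"

definition grid_x :: "real \<Rightarrow> real \<Rightarrow> nat \<Rightarrow> real" where
  "grid_x xmin dx i = xmin + real i * dx"

definition grid_t :: "real \<Rightarrow> nat \<Rightarrow> real" where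
  "grid_t dt k = real k * dt"

definition time_index :: "real \<Rightarrow> real \<Rightarrow> nat" where
  "time_index dt t = nat \<lfloor>t / dt\<rfloor>"

definition A_h :: "real \<Rightarrow> real \<Rightarrow> (nat \<Rightarrow> real) \<Rightarrow> nat \<Rightarrow> real" where
  "A_h c dx q i = - c\<^sup>2 * ((q (i + 1) - 2 * q i + q (i - 1)) / dx\<^sup>2)"

definition discrete_solution ::
  "real \<Rightarrow> nat \<Rightarrow> nat \<Rightarrow> real \<Rightarrow> real \<Rightarrow> (nat \<Rightarrow> real) \<Rightarrow> (nat \<Rightarrow> real) \<Rightarrow> (nat \<Rightarrow> nat \<Rightarrow> real) \<Rightarrow>
   (nat \<Rightarrow> nat \<Rightarrow> real) \<Rightarrow> bool" where
  "discrete_solution c imax kmax dx dt u0 u1 s ph \<longleftrightarrow>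
     (\<forall>k\<in>{2..kmax}. \<forall>i\<in>{1..imax - 1}.
        (ph k i - 2 * ph (k - 1) i + ph (k - 2) i) / dt\<^sup>2 + A_h c dx (ph (k - 1)) i = s (k - 1) i) \<and>
     (\<forall>i\<in>{1..imax - 1}.
        (ph 1 i - ph 0 i) / dt + dt / 2 * A_h c dx (ph 0) i = u1 i \<and> ph 0 i = u0 i) \<and>
     (\<forall>k\<in>{0..kmax}. ph k 0 = 0 \<and> ph k imax = 0)"

definition dx_norm :: "nat \<Rightarrow> real \<Rightarrow> (nat \<Rightarrow> real) \<Rightarrow> real" where
  "dx_norm imax dx q = sqrt (\<Sum>i=1..imax - 1. (q i)\<^sup>2 * dx)"

definition convergence_error ::
  "real \<Rightarrow> real \<Rightarrow> real \<Rightarrow> (real \<times> real \<Rightarrow> real) \<Rightarrow> (nat \<Rightarrow> nat \<Rightarrow> real) \<Rightarrow> nat \<Rightarrow> nat \<Rightarrow> real" where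
  "convergence_error xmin dx dt p ph k i = p (grid_x xmin dx i, grid_t dt k) - ph k i"

definition CFL :: "real \<Rightarrow> real \<Rightarrow> real \<Rightarrow> real \<Rightarrow> bool" where
  "CFL \<xi> c dx dt \<longleftrightarrow> c * dt / dx \<le> 1 - \<xi>"

end

theory Submission
  imports Defs
begin

text \<open>
  Taylor expansion of order 3 shows that the exact solution satisfies the scheme up to a
  source term of size \<open>O(\<Delta>x\<^sup>2 + \<Delta>t\<^sup>2)\<close>, and an expansion of order 2 does the same for the first step.
  The error \<open>e\<close> therefore solves the scheme with zero data at \<open>t = 0\<close> and these sources. With
  \<open>r = c \<Delta>t / \<Delta>x\<close>, the discrete energy \<open>\<parallel>e\<^sup>k\<^sup>+\<^sup>1 - e\<^sup>k\<parallel>\<^sup>2 + r\<^sup>2 \<langle>\<nabla>e\<^sup>k, \<nabla>e\<^sup>k\<^sup>+\<^sup>1\<rangle>\<close> dominates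
  \<open>(1 - r\<^sup>2) \<parallel>e\<^sup>k\<^sup>+\<^sup>1 - e\<^sup>k\<parallel>\<^sup>2\<close>, and its square root grows in each step by at most a multiple of the source.
\<close>

section \<open>Stability\<close>

text \<open>The boundary term at \<open>m + 1\<close> is kept explicit so that a plain induction on
  \<open>m\<close> works; it drops out when \<open>r\<close> also vanishes there.\<close>

lemma discrete_integration_by_parts:
  fixes q r :: "nat \<Rightarrow> real"
  assumes "r 0 = 0"
  shows "(\<Sum>i=1..m. (q (i + 1) - 2 * q i + q (i - 1)) * r i)
     = (q (m + 1) - q m) * r (m + 1) - (\<Sum>i<Suc m. (q (i + 1) - q i) * (r (i + 1) - r i))"
  by (induction m) (auto simp: assms algebra_simps)

text \<open>By (x - y)^2 <= 2 x^2 + 2 y^2. Each inner value enters two differences, which gives the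
  factor 4; the last value enters only one.\<close>

lemma discrete_gradient_bound:
  fixes q :: "nat \<Rightarrow> real"
  assumes "q 0 = 0"
  shows "(\<Sum>i<Suc m. (q (i + 1) - q i)\<^sup>2) \<le> 4 * (\<Sum>i=1..m. (q i)\<^sup>2) + 2 * (q (Suc m))\<^sup>2"
proof (induction m)
  case 0
  then show ?case by (simp add: assms)
next
  case (Suc m)
  have "(q (Suc (Suc m)) - q (Suc m))\<^sup>2 \<le> 2 * (q (Suc m))\<^sup>2 + 2 * (q (Suc (Suc m)))\<^sup>2"
    using sum_squares_bound[of "q (Suc m)" "- q (Suc (Suc m))"]
    by (simp add: power2_eq_square algebra_simps)
  with Suc show ?case by simp
qed

text \<open>Coercivity of the energy, by polarization: four times the gradient product is the
  squared gradient of \<open>a + b\<close> minus that of \<open>b - a\<close>, and the latter is at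
  most four times the squared norm of \<open>b - a\<close>. The CFL condition enters through
  \<open>\<delta>\<close>.\<close>

lemma wave_energy_bound:
  fixes a b :: "nat \<Rightarrow> real"
  assumes "a 0 = 0" "b 0 = 0" "a (Suc m) = 0" "b (Suc m) = 0" and "\<delta>\<^sup>2 \<le> 1 - r\<^sup>2"
  shows "\<delta>\<^sup>2 * (\<Sum>i=1..m. (b i - a i)\<^sup>2)
    \<le> (\<Sum>i=1..m. (b i - a i)\<^sup>2) + r\<^sup>2 * (\<Sum>i<Suc m. (a (i + 1) - a i) * (b (i + 1) - b i))"
proof -
  let ?S = "\<Sum>i=1..m. (b i - a i)\<^sup>2"
  let ?d = "\<lambda>i. b i - a i"
  have "- (\<Sum>i<Suc m. (?d (i + 1) - ?d i)\<^sup>2)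
      \<le> 4 * (\<Sum>i<Suc m. (a (i + 1) - a i) * (b (i + 1) - b i))"
    unfolding sum_negf[symmetric] sum_distrib_left
  proof (rule sum_mono)
    fix i
    have "4 * ((a (i + 1) - a i) * (b (i + 1) - b i)) + (?d (i + 1) - ?d i)\<^sup>2
        = (a (i + 1) - a i + (b (i + 1) - b i))\<^sup>2"
      by (simp add: power2_eq_square algebra_simps)
    moreover have "0 \<le> \<dots>" by simp
    ultimately show "- (?d (i + 1) - ?d i)\<^sup>2 \<le> 4 * ((a (i + 1) - a i) * (b (i + 1) - b i))"
      by linarith
  qed
  moreover have "(\<Sum>i<Suc m. (?d (i + 1) - ?d i)\<^sup>2) \<le> 4 * ?S"
    using discrete_gradient_bound[of ?d m] assms by simp
  ultimately have "- ?S \<le> (\<Sum>i<Suc m. (a (i + 1) - a i) * (b (i + 1) - b i))"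
    by linarith
  then have "r\<^sup>2 * - ?S \<le> r\<^sup>2 * (\<Sum>i<Suc m. (a (i + 1) - a i) * (b (i + 1) - b i))"
    by (rule mult_left_mono) simp
  moreover have "\<delta>\<^sup>2 * ?S \<le> (1 - r\<^sup>2) * ?S"
    by (rule mult_right_mono) (use assms in \<open>auto intro: sum_nonneg\<close>)
  ultimately show ?thesis by (simp add: algebra_simps)
qed

text \<open>Energy identity for three consecutive time levels \<open>a\<close>, \<open>b\<close>,
  \<open>d\<close>. The scheme is multiplied by \<open>d - a\<close>: on the left (d - 2b + a)(d -
  a) = (d - b)^2 - (b - a)^2, on the right summation by parts yields the difference of the two
  gradient products.\<close>

lemma wave_energy_step:
  fixes a b d g :: "nat \<Rightarrow> real"
  assumes "a 0 = 0" "d 0 = 0" "a (Suc m) = 0" "d (Suc m) = 0"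
    and "\<And>i. i \<in> {1..m} \<Longrightarrow>
      d i - 2 * b i + a i = r\<^sup>2 * (b (i + 1) - 2 * b i + b (i - 1)) + g i"
  shows "(\<Sum>i=1..m. (d i - b i)\<^sup>2) + r\<^sup>2 * (\<Sum>i<Suc m. (b (i + 1) - b i) * (d (i + 1) - d i))
    = (\<Sum>i=1..m. (b i - a i)\<^sup>2) + r\<^sup>2 * (\<Sum>i<Suc m. (a (i + 1) - a i) * (b (i + 1) - b i))
      + (\<Sum>i=1..m. g i * (d i - a i))"
proof -
  have "(\<Sum>i=1..m. (d i - b i)\<^sup>2) - (\<Sum>i=1..m. (b i - a i)\<^sup>2)
      = (\<Sum>i=1..m. (d i - 2 * b i + a i) * (d i - a i))"
    unfolding sum_subtractf[symmetric]
    by (intro sum.cong) (auto simp: power2_eq_square algebra_simps)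
  also have "\<dots> = (\<Sum>i=1..m. (r\<^sup>2 * (b (i + 1) - 2 * b i + b (i - 1)) + g i) * (d i - a i))"
    by (intro sum.cong) (use assms(5) in auto)
  also have "\<dots> = r\<^sup>2 * (\<Sum>i=1..m. (b (i + 1) - 2 * b i + b (i - 1)) * (d i - a i))
      + (\<Sum>i=1..m. g i * (d i - a i))"
    unfolding sum_distrib_left sum.distrib[symmetric]
    by (intro sum.cong) (auto simp: algebra_simps)
  also have "(\<Sum>i=1..m. (b (i + 1) - 2 * b i + b (i - 1)) * (d i - a i))
      = - (\<Sum>i<Suc m. (b (i + 1) - b i) * ((d (i + 1) - a (i + 1)) - (d i - a i)))"
    using discrete_integration_by_parts[of "\<lambda>i. d i - a i" b m] assms by simp
  also have "(\<Sum>i<Suc m. (b (i + 1) - b i) * ((d (i + 1) - a (i + 1)) - (d i - a i)))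
      = (\<Sum>i<Suc m. (b (i + 1) - b i) * (d (i + 1) - d i))
        - (\<Sum>i<Suc m. (a (i + 1) - a i) * (b (i + 1) - b i))"
    unfolding sum_subtractf[symmetric] by (intro sum.cong) (auto simp: algebra_simps)
  finally show ?thesis
    by (simp only: right_diff_distrib[of "r\<^sup>2"] mult_minus_right)
qed

text \<open>All quantities are undivided: \<open>g\<close> stands for \<Delta>t^2 times a truncation
  error and \<open>B\<close> for \<Delta>t times one. Since \<open>k\<close> and \<open>K\<close>
  are of size 1/\<Delta>t, the bound then stays uniform under refinement.\<close>

lemma wave_scheme_stable:
  fixes e g :: "nat \<Rightarrow> nat \<Rightarrow> real"
  assumes bdry: "\<And>k. k \<le> K \<Longrightarrow> e k 0 = 0 \<and> e k (Suc m) = 0"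
    and init: "\<And>i. i \<le> Suc m \<Longrightarrow> e 0 i = 0"
    and scheme: "\<And>k i. Suc k < K \<Longrightarrow> i \<in> {1..m} \<Longrightarrow>
      e (k + 2) i - 2 * e (k + 1) i + e k i
        = r\<^sup>2 * (e (k + 1) (i + 1) - 2 * e (k + 1) i + e (k + 1) (i - 1)) + g (k + 1) i"
    and first: "0 < K \<Longrightarrow> L2_set (e 1) {1..m} \<le> B"
    and source: "\<And>k. 0 < k \<Longrightarrow> k < K \<Longrightarrow> L2_set (g k) {1..m} \<le> G"
    and "0 < \<delta>" "\<delta>\<^sup>2 \<le> 1 - r\<^sup>2" "0 \<le> G" "0 \<le> B"
    and "k \<le> K"
  shows "L2_set (e k) {1..m} \<le> real k * ((B + real K * (G / \<delta>)) / \<delta>)"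
proof -
  define D where "D k = L2_set (\<lambda>i. e (Suc k) i - e k i) {1..m}" for k
  define E where "E k = (\<Sum>i=1..m. (e (Suc k) i - e k i)\<^sup>2) +
      r\<^sup>2 * (\<Sum>i<Suc m. (e k (i + 1) - e k i) * (e (Suc k) (i + 1) - e (Suc k) i))" for k
  have E_ge: "(\<delta> * D k)\<^sup>2 \<le> E k" if "k < K" for k
    unfolding E_def D_def L2_set_def power_mult_distrib
    using wave_energy_bound[of "e k" "e (Suc k)" m \<delta> r] bdry that assms(7)
    by (simp add: sum_nonneg)
  have D_le: "D k \<le> sqrt (E k) / \<delta>" if "k < K" for k
    using real_le_rsqrt[OF E_ge[OF that]] \<open>0 < \<delta>\<close> by (simp add: field_simps)
  have E_nonneg: "0 \<le> E k" if "k < K" for k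
    using E_ge[OF that] by (meson order_trans zero_le_power2)
  have step: "sqrt (E (Suc k)) \<le> sqrt (E k) + G / \<delta>" if k: "Suc k < K" for k
  proof -
    have "E (Suc k) = E k + (\<Sum>i=1..m. g (k + 1) i * (e (k + 2) i - e k i))"
      unfolding E_def
      using wave_energy_step[of "e k" "e (k + 2)" m "e (Suc k)" r "g (k + 1)"] bdry scheme[OF k] k
      by simp
    also have "(\<Sum>i=1..m. g (k + 1) i * (e (k + 2) i - e k i))
        \<le> (\<Sum>i=1..m. \<bar>g (k + 1) i\<bar> * \<bar>e (k + 2) i - e k i\<bar>)"
      by (intro sum_mono) (metis abs_ge_self abs_mult)
    also have "\<dots> \<le> L2_set (g (k + 1)) {1..m} * L2_set (\<lambda>i. e (k + 2) i - e k i) {1..m}"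
      by (rule L2_set_mult_ineq)
    also have "\<dots> \<le> G * (D (Suc k) + D k)"
    proof (rule mult_mono)
      show "L2_set (g (k + 1)) {1..m} \<le> G" using source k by simp
      show "L2_set (\<lambda>i. e (k + 2) i - e k i) {1..m} \<le> D (Suc k) + D k"
        unfolding D_def
        using L2_set_triangle_ineq[of "\<lambda>i. e (Suc (Suc k)) i - e (Suc k) i"
            "\<lambda>i. e (Suc k) i - e k i" "{1..m}"] by simp
    qed (use \<open>0 \<le> G\<close> in \<open>auto simp: L2_set_nonneg\<close>)
    also have "\<dots> \<le> G * (sqrt (E (Suc k)) / \<delta> + sqrt (E k) / \<delta>)"
      by (intro mult_left_mono add_mono D_le) (use k \<open>0 \<le> G\<close> in auto)
    finally have le: "E (Suc k) \<le> E k + G / \<delta> * (sqrt (E (Suc k)) + sqrt (E k))"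
      by (simp add: add_divide_distrib distrib_left add_ac)
    have nn: "0 \<le> sqrt (E k)" "0 \<le> sqrt (E (Suc k))" "0 \<le> G / \<delta>"
      using E_nonneg k \<open>0 \<le> G\<close> \<open>0 < \<delta>\<close> by auto
    have sq: "(sqrt (E k))\<^sup>2 = E k" "(sqrt (E (Suc k)))\<^sup>2 = E (Suc k)"
      using E_nonneg k by auto
    show ?thesis
    \<comment> \<open>With s, s' the two square roots, \<open>le\<close> reads (s' - s)(s' + s) <=
      (G / \<delta>)(s' + s). Denying the claim forces s' > 0, so the common factor is positive and
      no separate case of zero energy arises.\<close>
    proof (rule ccontr)
      assume "\<not> ?thesis"
      then have "0 < (sqrt (E (Suc k)) - sqrt (E k) - G / \<delta>) * (sqrt (E (Suc k)) + sqrt (E k))"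
        using nn by (intro mult_pos_pos; linarith)
      then have "(sqrt (E k))\<^sup>2 + G / \<delta> * (sqrt (E (Suc k)) + sqrt (E k)) < (sqrt (E (Suc k)))\<^sup>2"
        by (simp only: power2_eq_square algebra_simps)
      with le sq show False by simp
    qed
  qed
  have E_le: "sqrt (E k) \<le> B + real k * (G / \<delta>)" if "k < K" for k
    using that
  proof (induction k)
    case 0
    \<comment> \<open>The gradient product contains \<open>e 0\<close> as a factor and vanishes, so
      the initial energy is just the squared norm of \<open>e 1\<close>.\<close>
    have "E 0 = (\<Sum>i=1..m. (e 1 i)\<^sup>2)"
      using init by (simp add: E_def)
    then show ?case using first 0 by (simp add: L2_set_def)
  next
    case (Suc k)
    then show ?case using step[of k] by (simp add: algebra_simps)
  qed
  show ?thesis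
    using \<open>k \<le> K\<close>
  proof (induction k)
    case 0
    have "L2_set (e 0) {1..m} = 0" using init by (simp add: L2_set_def)
    then show ?case by simp
  next
    case (Suc k)
    then have k: "k < K" by simp
    have "L2_set (e (Suc k)) {1..m} \<le> L2_set (e k) {1..m} + D k"
      unfolding D_def
      using L2_set_triangle_ineq[of "e k" "\<lambda>i. e (Suc k) i - e k i" "{1..m}"] by simp
    \<comment> \<open>Replacing \<open>k\<close> by \<open>K\<close> makes the increment bound the
      same at every step, so summing only multiplies it by the number of steps.\<close>
    also have "D k \<le> (B + real K * (G / \<delta>)) / \<delta>"
    proof (rule order_trans[OF D_le[OF k] divide_right_mono])
      have "real k * (G / \<delta>) \<le> real K * (G / \<delta>)"
        using k \<open>0 < \<delta>\<close> \<open>0 \<le> G\<close> by (intro mult_right_mono) auto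
      with E_le[OF k] show "sqrt (E k) \<le> B + real K * (G / \<delta>)" by simp
    qed (use \<open>0 < \<delta>\<close> in simp)
    finally show ?case
      unfolding of_nat_Suc distrib_right using Suc by simp
  qed
qed

text \<open>The factor uses \<open>Suc m\<close>, the number of cells, rather than the
  \<open>m\<close> inner nodes: \<open>Suc m\<close> times \<Delta>x is exactly the length of the
  interval.\<close>

lemma L2_set_le_const:
  fixes f :: "nat \<Rightarrow> real"
  assumes "\<And>i. i \<in> {1..m} \<Longrightarrow> \<bar>f i\<bar> \<le> M" and "0 \<le> M"
  shows "L2_set f {1..m} \<le> sqrt (real (Suc m)) * M"
proof -
  have "(\<Sum>i=1..m. (f i)\<^sup>2) \<le> (\<Sum>i=1..m. M\<^sup>2)"
    by (intro sum_mono) (use assms in \<open>simp add: abs_le_square_iff[symmetric]\<close>)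
  also have "\<dots> \<le> real (Suc m) * M\<^sup>2"
    by (simp add: mult_right_mono)
  finally show ?thesis
    unfolding L2_set_def using assms(2) by (metis real_sqrt_le_iff real_sqrt_mult real_sqrt_unique)
qed

section \<open>Consistency\<close>

text \<open>Since \<open>0 ^ 0 = 1\<close>, exactly the summand \<open>m = q\<close> survives, so
  along an axis the plane Taylor polynomial is the one-variable one.\<close>

lemma taylor_poly_x: "taylor_poly n f z (a, 0) = (\<Sum>q=0..n. partial_deriv q 0 f z * a ^ q / fact q)"
proof -
  have "(\<Sum>m=0..q. real (q choose m) * partial_deriv m (q - m) f z * a ^ m * 0 ^ (q - m))
      = partial_deriv q 0 f z * a ^ q" for q
  proof -
    have "(\<Sum>m=0..q. real (q choose m) * partial_deriv m (q - m) f z * a ^ m * 0 ^ (q - m))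
        = (\<Sum>m\<in>{q}. real (q choose m) * partial_deriv m (q - m) f z * a ^ m * 0 ^ (q - m))"
      by (rule sum.mono_neutral_right) auto
    then show ?thesis by simp
  qed
  then show ?thesis by (simp add: taylor_poly_def)
qed

lemma taylor_poly_t: "taylor_poly n f z (0, b) = (\<Sum>q=0..n. partial_deriv 0 q f z * b ^ q / fact q)"
proof -
  have "(\<Sum>m=0..q. real (q choose m) * partial_deriv m (q - m) f z * 0 ^ m * b ^ (q - m))
      = partial_deriv 0 q f z * b ^ q" for q
  proof -
    have "(\<Sum>m=0..q. real (q choose m) * partial_deriv m (q - m) f z * 0 ^ m * b ^ (q - m))
        = (\<Sum>m\<in>{0}. real (q choose m) * partial_deriv m (q - m) f z * 0 ^ m * b ^ (q - m))"
      by (rule sum.mono_neutral_right) auto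
    then show ?thesis by simp
  qed
  then show ?thesis by (simp add: taylor_poly_def)
qed

text \<open>The linear and cubic terms cancel between \<open>h\<close> and \<open>- h\<close>. Two
  fourth-order remainders are left, and division by \<open>h\<^sup>2\<close> leaves second
  order.\<close>

lemma second_difference_remainder:
  fixes g :: "real \<Rightarrow> real"
  assumes "\<And>a. a \<in> {h, - h} \<Longrightarrow> \<bar>g (x + a) - (\<Sum>q=0..3. D q * a ^ q / fact q)\<bar> \<le> C * h ^ 4"
    and "D 0 = g x" and "0 < h"
  shows "\<bar>(g (x + h) - 2 * g x + g (x - h)) / h\<^sup>2 - D 2\<bar> \<le> 2 * C * h\<^sup>2"
proof -
  have poly: "(\<Sum>q=0..3. D q * a ^ q / fact q)
      = g x + D 1 * a + D 2 * a\<^sup>2 / 2 + D 3 * a ^ 3 / 6" for a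
    by (simp add: numeral_eq_Suc assms(2))
  have "\<bar>g (x + h) - 2 * g x + g (x - h) - D 2 * h\<^sup>2\<bar> \<le> 2 * C * h ^ 4"
    using assms(1)[of h] assms(1)[of "- h"] by (simp add: poly)
  moreover have "(g (x + h) - 2 * g x + g (x - h)) / h\<^sup>2 - D 2
      = (g (x + h) - 2 * g x + g (x - h) - D 2 * h\<^sup>2) / h\<^sup>2"
    using assms(3) by (simp add: field_simps)
  moreover have "2 * C * h ^ 4 = 2 * C * h\<^sup>2 * h\<^sup>2" by (simp add: power2_eq_square power4_eq_xxxx)
  ultimately show ?thesis using assms(3) by (simp add: abs_divide divide_le_eq)
qed

text \<open>Bridges the one-sided derivatives of the equation and the two-sided \<open>deriv\<close>
  of the Taylor polynomials: a two-sided derivative is also one within \<open>A\<close>, where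
  derivatives are unique.\<close>

lemma deriv_within_unique:
  fixes g g1 :: "real \<Rightarrow> real"
  assumes lim: "\<And>s. s \<in> A \<Longrightarrow> at s within A \<noteq> bot" and "t \<in> A"
    and g1: "\<And>s. s \<in> A \<Longrightarrow> (g has_real_derivative g1 s) (at s within A)"
    and g2: "(g1 has_real_derivative g2) (at t within A)"
    and ev: "\<forall>\<^sub>F s in nhds t. g field_differentiable at s"
    and diff: "deriv g field_differentiable at t"
  shows "deriv g t = g1 t" "deriv (deriv g) t = g2"
proof -
  have unique: "a = b" if "s \<in> A" "(f has_real_derivative a) (at s within A)"
    "(f has_real_derivative b) (at s within A)" for f a b s
    using vector_derivative_unique_within[OF lim[OF that(1)]] that(2,3)
    by (simp add: has_real_derivative_iff_has_vector_derivative)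
  have eq: "deriv g s = g1 s" if "s \<in> A" "g field_differentiable at s" for s
    using unique[OF that(1) _ g1[OF that(1)]] that(2)
    by (simp add: DERIV_deriv_iff_field_differentiable has_field_derivative_at_within)
  show "deriv g t = g1 t"
    using eq[OF \<open>t \<in> A\<close>] eventually_nhds_x_imp_x[OF ev] by blast
  have "(deriv g has_real_derivative deriv (deriv g) t) (at t within A)"
    using diff by (simp add: DERIV_deriv_iff_field_differentiable has_field_derivative_at_within)
  \<comment> \<open>\<open>deriv g\<close> and \<open>g1\<close> are known to agree only at points
    of \<open>A\<close> near \<open>t\<close>, which suffices for a derivative within
    \<open>A\<close>.\<close>
  moreover have "(deriv g has_real_derivative g2) (at t within A)
      \<longleftrightarrow> (g1 has_real_derivative g2) (at t within A)"
  proof (rule has_field_derivative_cong_eventually)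
    show "\<forall>\<^sub>F s in at t within A. deriv g s = g1 s"
      using ev eq unfolding eventually_at_filter by (auto elim: eventually_mono)
    show "deriv g t = g1 t" by fact
  qed
  ultimately show "deriv (deriv g) t = g2"
    using unique[OF \<open>t \<in> A\<close>] g2 by blast
qed

text \<open>Transfers the wave equation and the initial velocity to the coefficients of the Taylor
  polynomials; regularity provides the two-sided derivatives, also on the boundary.\<close>

lemma exact_solution_partial_derivs:
  assumes ex: "exact_solution xmin xmax c p0 p1 p"
    and reg: "sufficiently_regular 4 p ({xmin..xmax} \<times> {0..tmax})"
    and "xmin < xmax" and x: "x \<in> {xmin..xmax}" and t: "t \<in> {0..tmax}"
  shows "partial_deriv 0 2 p (x, t) = c\<^sup>2 * partial_deriv 2 0 p (x, t)"
    and "t = 0 \<Longrightarrow> partial_deriv 0 1 p (x, t) = p1 x"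
proof -
  obtain pt ptt px pxx :: "real \<Rightarrow> real \<Rightarrow> real" where
    pt: "\<And>x t. x \<in> {xmin..xmax} \<Longrightarrow> t \<in> {0..} \<Longrightarrow>
        ((\<lambda>s. p (x, s)) has_real_derivative pt x t) (at t within {0..})"
    and ptt: "\<And>x t. x \<in> {xmin..xmax} \<Longrightarrow> t \<in> {0..} \<Longrightarrow>
        (pt x has_real_derivative ptt x t) (at t within {0..})"
    and px: "\<And>x t. x \<in> {xmin..xmax} \<Longrightarrow> t \<in> {0..} \<Longrightarrow>
        ((\<lambda>y. p (y, t)) has_real_derivative px x t) (at x within {xmin..xmax})"
    and pxx: "\<And>x t. x \<in> {xmin..xmax} \<Longrightarrow> t \<in> {0..} \<Longrightarrow>
        ((\<lambda>y. px y t) has_real_derivative pxx x t) (at x within {xmin..xmax})"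
    and wave: "\<And>x t. x \<in> {xmin..xmax} \<Longrightarrow> t \<in> {0..} \<Longrightarrow>
        ptt x t - c\<^sup>2 * pxx x t = 0"
    and p1: "\<And>x. x \<in> {xmin..xmax} \<Longrightarrow> pt x 0 = p1 x"
    using ex unfolding exact_solution_def atLeast_iff by blast
  have t0: "t \<in> {0..}" using t by simp
  \<comment> \<open>Regularity of order 4 concerns the Taylor polynomials of order below 4, hence
    derivatives up to total order 3.\<close>
  have exists: "partial_deriv_exists m (q - m) p (x, t)" if "q \<le> 3" "m \<le> q" for q m
    using reg x t that unfolding sufficiently_regular_def
    by (metis SigmaI eval_nat_numeral(2) eval_nat_numeral(3) lessI semiring_norm(26,27))
  have time: "deriv (\<lambda>s. p (x, s)) t = pt x t" "deriv (deriv (\<lambda>s. p (x, s))) t = ptt x t"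
  proof -
    have *: "\<forall>\<^sub>F s in nhds t. (\<lambda>s. p (x, s)) field_differentiable at s"
      "deriv (\<lambda>s. p (x, s)) field_differentiable at t"
      using exists[of 2 0] by (simp_all add: numeral_eq_Suc partial_deriv_def)
    have lim: "at s within {0..} \<noteq> bot" if "s \<in> {0..}" for s :: real
      using at_le[of "{s<..}" "{0..}" s] trivial_limit_at_right_real[of s] that
      by (force simp: bot_unique)
    show "deriv (\<lambda>s. p (x, s)) t = pt x t" "deriv (deriv (\<lambda>s. p (x, s))) t = ptt x t"
      using deriv_within_unique[OF lim t0 pt[OF x] ptt[OF x t0] *] by blast+
  qed
  have space: "deriv (deriv (\<lambda>y. p (y, t))) x = pxx x t"
  proof -
    have *: "\<forall>\<^sub>F y in nhds x. (\<lambda>y. p (y, t)) field_differentiable at y"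
      "deriv (\<lambda>y. p (y, t)) field_differentiable at x"
      using exists[of 2 2] by (simp_all add: numeral_eq_Suc partial_deriv_def)
    have lim: "at y within {xmin..xmax} \<noteq> bot" if "y \<in> {xmin..xmax}" for y :: real
      using that \<open>xmin < xmax\<close> by (simp add: trivial_limit_within)
    show ?thesis
      using deriv_within_unique(2)[OF lim x px[OF _ t0] pxx[OF x t0] *] by blast
  qed
  show "partial_deriv 0 2 p (x, t) = c\<^sup>2 * partial_deriv 2 0 p (x, t)"
    using wave[OF x t0] time space by (simp add: partial_deriv_def numeral_eq_Suc)
  show "partial_deriv 0 1 p (x, t) = p1 x" if "t = 0"
    using p1 x time that by (simp add: partial_deriv_def)
qed

text \<open>The Taylor bounds are centred in the rectangle but hold for every small displacement, so
  stencil points may lie outside it. Both constants are independent of the grid.\<close>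

lemma wave_scheme_consistent:
  assumes ex: "exact_solution xmin xmax c p0 p1 p"
    and reg: "sufficiently_regular 4 p ({xmin..xmax} \<times> {0..tmax})"
    and "xmin < xmax" "0 < tmax"
  obtains \<alpha> M where "0 < \<alpha>" "0 < M"
    and "\<And>x t dx dt. x \<in> {xmin..xmax} \<Longrightarrow> t \<in> {0..tmax} \<Longrightarrow> 0 < dx \<Longrightarrow> dx < \<alpha> \<Longrightarrow> 0 < dt \<Longrightarrow> dt < \<alpha> \<Longrightarrow>
      \<bar>(p (x, t + dt) - 2 * p (x, t) + p (x, t - dt)) / dt\<^sup>2
        - c\<^sup>2 * ((p (x + dx, t) - 2 * p (x, t) + p (x - dx, t)) / dx\<^sup>2)\<bar> \<le> M * (dx\<^sup>2 + dt\<^sup>2)"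
    and "\<And>x dx dt. x \<in> {xmin..xmax} \<Longrightarrow> 0 < dx \<Longrightarrow> dx < \<alpha> \<Longrightarrow> 0 < dt \<Longrightarrow> dt < \<alpha> \<Longrightarrow>
      \<bar>(p (x, dt) - p (x, 0)) / dt
        - dt / 2 * (c\<^sup>2 * ((p (x + dx, 0) - 2 * p (x, 0) + p (x - dx, 0)) / dx\<^sup>2)) - p1 x\<bar>
        \<le> M * (dx\<^sup>2 + dt\<^sup>2)"
proof -
  let ?S = "{xmin..xmax} \<times> {0..tmax}"
  have "taylor_uniform_approx 3 p ?S" "taylor_uniform_approx 2 p ?S"
    using reg by (auto simp: sufficiently_regular_def)
  then obtain \<alpha>3 C3 \<alpha>2 C2 where
    pos: "0 < \<alpha>3" "0 < C3" "0 < \<alpha>2" "0 < C2"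
    and T3: "\<And>z h. z \<in> ?S \<Longrightarrow> norm h < \<alpha>3 \<Longrightarrow> \<bar>p (z + h) - taylor_poly 3 p z h\<bar> \<le> C3 * norm h ^ 4"
    and T2: "\<And>z h. z \<in> ?S \<Longrightarrow> norm h < \<alpha>2 \<Longrightarrow> \<bar>p (z + h) - taylor_poly 2 p z h\<bar> \<le> C2 * norm h ^ 3"
    unfolding taylor_uniform_approx_def by (auto simp: numeral_eq_Suc)
  define \<alpha> where "\<alpha> = min \<alpha>2 \<alpha>3"
  \<comment> \<open>The first summand covers the interior scheme, where the coefficients are
    \<open>2 * C3\<close> and \<open>2 * C3 * c\<^sup>2\<close>; the other two cover the first time
    step.\<close>
  define M where "M = 2 * C3 * (1 + c\<^sup>2) + C2 + \<alpha> * C3 * c\<^sup>2"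
  have "0 < \<alpha>" using pos by (simp add: \<alpha>_def)
  have xx: "\<bar>(p (x + h, t) - 2 * p (x, t) + p (x - h, t)) / h\<^sup>2 - partial_deriv 2 0 p (x, t)\<bar>
      \<le> 2 * C3 * h\<^sup>2" if "(x, t) \<in> ?S" "0 < h" "h < \<alpha>" for x t h
  proof (rule second_difference_remainder[of h "\<lambda>y. p (y, t)" x "\<lambda>q. partial_deriv q 0 p (x, t)"])
    fix a assume "a \<in> {h, - h}"
    then show "\<bar>p (x + a, t) - (\<Sum>q = 0..3. partial_deriv q 0 p (x, t) * a ^ q / fact q)\<bar> \<le> C3 * h ^ 4"
      using T3[OF that(1), of "(a, 0)"] that(2,3)
      by (auto simp: taylor_poly_x norm_Pair \<alpha>_def)
  qed (use that in \<open>auto simp: partial_deriv_def\<close>)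
  have tt: "\<bar>(p (x, t + h) - 2 * p (x, t) + p (x, t - h)) / h\<^sup>2 - partial_deriv 0 2 p (x, t)\<bar>
      \<le> 2 * C3 * h\<^sup>2" if "(x, t) \<in> ?S" "0 < h" "h < \<alpha>" for x t h
  proof (rule second_difference_remainder[of h "\<lambda>s. p (x, s)" t "\<lambda>q. partial_deriv 0 q p (x, t)"])
    fix a assume "a \<in> {h, - h}"
    then show "\<bar>p (x, t + a) - (\<Sum>q = 0..3. partial_deriv 0 q p (x, t) * a ^ q / fact q)\<bar> \<le> C3 * h ^ 4"
      using T3[OF that(1), of "(0, a)"] that(2,3)
      by (auto simp: taylor_poly_t norm_Pair \<alpha>_def)
  qed (use that in \<open>auto simp: partial_deriv_def\<close>)
  \<comment> \<open>Through the wave equation the space difference is compared with the second time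
    derivative, so that it cancels against the one in \<open>tt\<close>.\<close>
  have cxx: "\<bar>c\<^sup>2 * ((p (x + h, t) - 2 * p (x, t) + p (x - h, t)) / h\<^sup>2) - partial_deriv 0 2 p (x, t)\<bar>
      \<le> 2 * C3 * c\<^sup>2 * h\<^sup>2" if "(x, t) \<in> ?S" "0 < h" "h < \<alpha>" for x t h
  proof -
    have "partial_deriv 0 2 p (x, t) = c\<^sup>2 * partial_deriv 2 0 p (x, t)"
      using exact_solution_partial_derivs(1)[OF ex reg \<open>xmin < xmax\<close>] that(1) by simp
    then have "\<bar>c\<^sup>2 * ((p (x + h, t) - 2 * p (x, t) + p (x - h, t)) / h\<^sup>2) - partial_deriv 0 2 p (x, t)\<bar>
      = c\<^sup>2 * \<bar>(p (x + h, t) - 2 * p (x, t) + p (x - h, t)) / h\<^sup>2 - partial_deriv 2 0 p (x, t)\<bar>"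
      by (simp add: right_diff_distrib[symmetric] abs_mult del: times_divide_eq_right)
    also have "\<dots> \<le> c\<^sup>2 * (2 * C3 * h\<^sup>2)"
      by (intro mult_left_mono xx that) auto
    finally show ?thesis by (simp add: mult_ac)
  qed
  show ?thesis
  proof (rule that[of \<alpha> M])
    show "0 < \<alpha>" by fact
    show "0 < M" using pos \<open>0 < \<alpha>\<close> unfolding M_def
      by (intro add_pos_nonneg add_nonneg_pos) auto
  next
    fix x t dx dt :: real
    assume *: "x \<in> {xmin..xmax}" "t \<in> {0..tmax}" "0 < dx" "dx < \<alpha>" "0 < dt" "dt < \<alpha>"
    have "\<bar>(p (x, t + dt) - 2 * p (x, t) + p (x, t - dt)) / dt\<^sup>2
        - c\<^sup>2 * ((p (x + dx, t) - 2 * p (x, t) + p (x - dx, t)) / dx\<^sup>2)\<bar>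
        \<le> 2 * C3 * dt\<^sup>2 + 2 * C3 * c\<^sup>2 * dx\<^sup>2"
      using tt[of x t dt] cxx[of x t dx] * by (auto simp: abs_le_iff)
    also have "\<dots> \<le> M * dt\<^sup>2 + M * dx\<^sup>2"
      using pos \<open>0 < \<alpha>\<close> unfolding M_def
      by (intro add_mono mult_right_mono) (auto simp: algebra_simps)
    finally show "\<bar>(p (x, t + dt) - 2 * p (x, t) + p (x, t - dt)) / dt\<^sup>2
        - c\<^sup>2 * ((p (x + dx, t) - 2 * p (x, t) + p (x - dx, t)) / dx\<^sup>2)\<bar> \<le> M * (dx\<^sup>2 + dt\<^sup>2)"
      by (simp add: algebra_simps)
  next
    fix x dx dt :: real
    assume *: "x \<in> {xmin..xmax}" "0 < dx" "dx < \<alpha>" "0 < dt" "dt < \<alpha>"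
    have S: "(x, 0) \<in> ?S" using * \<open>0 < tmax\<close> by simp
    let ?d = "partial_deriv 0 2 p (x, 0)"
    let ?X = "c\<^sup>2 * ((p (x + dx, 0) - 2 * p (x, 0) + p (x - dx, 0)) / dx\<^sup>2)"
    have "partial_deriv 0 1 p (x, 0) = p1 x"
      using exact_solution_partial_derivs(2)[OF ex reg \<open>xmin < xmax\<close>, of x 0] S by simp
    then have poly: "taylor_poly 2 p (x, 0) (0, dt) = p (x, 0) + p1 x * dt + ?d * dt\<^sup>2 / 2"
      by (simp add: taylor_poly_t numeral_eq_Suc) (simp add: partial_deriv_def)
    have "\<bar>p (x, dt) - (p (x, 0) + p1 x * dt + ?d * dt\<^sup>2 / 2)\<bar> \<le> C2 * dt ^ 3"
      using T2[OF S, of "(0, dt)"] * by (simp add: poly norm_Pair \<alpha>_def)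
    \<comment> \<open>The correction with factor \<open>dt / 2\<close> removes the quadratic Taylor
      term; the cubic remainder divided by \<open>dt\<close> is of second order.\<close>
    moreover have "(p (x, dt) - p (x, 0)) / dt - dt / 2 * ?d - p1 x
        = (p (x, dt) - (p (x, 0) + p1 x * dt + ?d * dt\<^sup>2 / 2)) / dt"
      using * by (simp add: field_simps power2_eq_square)
    ultimately have 1: "\<bar>(p (x, dt) - p (x, 0)) / dt - dt / 2 * ?d - p1 x\<bar> \<le> C2 * dt\<^sup>2"
      using * by (simp add: abs_divide divide_le_eq power2_eq_square power3_eq_cube mult.assoc)
    have "\<bar>dt / 2 * (?X - ?d)\<bar> = dt / 2 * \<bar>?X - ?d\<bar>" using * by (simp add: abs_mult)
    also have "\<dots> \<le> \<alpha> / 2 * (2 * C3 * c\<^sup>2 * dx\<^sup>2)"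
      using * by (intro mult_mono cxx S) auto
    finally have 2: "\<bar>dt / 2 * ?X - dt / 2 * ?d\<bar> \<le> \<alpha> * C3 * c\<^sup>2 * dx\<^sup>2"
      by (simp add: right_diff_distrib mult_ac)
    have "\<bar>(p (x, dt) - p (x, 0)) / dt - dt / 2 * ?X - p1 x\<bar> \<le> C2 * dt\<^sup>2 + \<alpha> * C3 * c\<^sup>2 * dx\<^sup>2"
      using 1 2 unfolding abs_le_iff by linarith
    also have "\<dots> \<le> M * dt\<^sup>2 + M * dx\<^sup>2"
      using pos \<open>0 < \<alpha>\<close> unfolding M_def
      by (intro add_mono mult_right_mono) (auto simp: algebra_simps)
    finally show "\<bar>(p (x, dt) - p (x, 0)) / dt - dt / 2 * ?X - p1 x\<bar> \<le> M * (dx\<^sup>2 + dt\<^sup>2)"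
      by (simp add: algebra_simps)
  qed
qed

section \<open>Convergence\<close>

theorem theorem4p1:
  fixes \<xi> xmin xmax c tmax :: real
    and p0 p1 :: "real \<Rightarrow> real"
    and p :: "real \<times> real \<Rightarrow> real"
  assumes "0 < \<xi>" and "\<xi> < 1"
    and "xmin < xmax" and "0 < c" and "0 < tmax"
    and "exact_solution xmin xmax c p0 p1 p"
    and "sufficiently_regular 4 p ({xmin..xmax} \<times> {0..tmax})"
  shows "\<exists>\<alpha>>0. \<exists>C>0. \<forall>t\<in>{0..tmax}. \<forall>imax kmax dx dt ph.
    discretization xmin xmax tmax imax kmax dx dt \<longrightarrow>
    CFL \<xi> c dx dt \<longrightarrow>
    sqrt (dx\<^sup>2 + dt\<^sup>2) < \<alpha> \<longrightarrow>
    discrete_solution c imax kmax dx dt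
      (\<lambda>i. p0 (grid_x xmin dx i)) (\<lambda>i. p1 (grid_x xmin dx i)) (\<lambda>k i. 0) ph \<longrightarrow>
    dx_norm imax dx (convergence_error xmin dx dt p ph (time_index dt t)) \<le> C * (dx\<^sup>2 + dt\<^sup>2)"
proof -
  obtain \<alpha> M where pos: "0 < \<alpha>" "0 < M"
    and trunc: "\<And>x t dx dt. x \<in> {xmin..xmax} \<Longrightarrow> t \<in> {0..tmax} \<Longrightarrow> 0 < dx \<Longrightarrow> dx < \<alpha> \<Longrightarrow> 0 < dt \<Longrightarrow> dt < \<alpha> \<Longrightarrow>
      \<bar>(p (x, t + dt) - 2 * p (x, t) + p (x, t - dt)) / dt\<^sup>2
        - c\<^sup>2 * ((p (x + dx, t) - 2 * p (x, t) + p (x - dx, t)) / dx\<^sup>2)\<bar> \<le> M * (dx\<^sup>2 + dt\<^sup>2)"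
    and trunc1: "\<And>x dx dt. x \<in> {xmin..xmax} \<Longrightarrow> 0 < dx \<Longrightarrow> dx < \<alpha> \<Longrightarrow> 0 < dt \<Longrightarrow> dt < \<alpha> \<Longrightarrow>
      \<bar>(p (x, dt) - p (x, 0)) / dt
        - dt / 2 * (c\<^sup>2 * ((p (x + dx, 0) - 2 * p (x, 0) + p (x - dx, 0)) / dx\<^sup>2)) - p1 x\<bar>
        \<le> M * (dx\<^sup>2 + dt\<^sup>2)"
    by (rule wave_scheme_consistent[OF assms(6,7,3,5)]) (rule that; blast)
  have p_init: "p (x, 0) = p0 x" if "x \<in> {xmin..xmax}" for x
    using assms(6) that by (auto simp: exact_solution_def)
  have p_bdry: "p (xmin, t) = 0 \<and> p (xmax, t) = 0" if "0 \<le> t" for t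
    using assms(6) that by (auto simp: exact_solution_def)
  \<comment> \<open>The coercivity constant for the largest ratio that CFL allows, hence valid for
    all admissible grids at once.\<close>
  define \<delta> where "\<delta> = sqrt (1 - (1 - \<xi>)\<^sup>2)"
  have "(1 - \<xi>)\<^sup>2 < 1" using assms(1,2) by (simp add: power2_less_1_iff abs_if)
  then have \<delta>: "0 < \<delta>" "\<delta>\<^sup>2 = 1 - (1 - \<xi>)\<^sup>2" by (simp_all add: \<delta>_def)
  define C where "C = sqrt (xmax - xmin) * (tmax * M + tmax * (tmax * M / \<delta>)) / \<delta>"
  have "0 < C"
    unfolding C_def using assms(3,5) pos \<delta>
    by (intro divide_pos_pos mult_pos_pos add_pos_pos) auto
  show ?thesis
  proof (rule exI[of _ \<alpha>], rule conjI[OF \<open>0 < \<alpha>\<close>], rule exI[of _ C], rule conjI[OF \<open>0 < C\<close>],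
      intro ballI allI impI)
    fix t imax kmax dx dt ph
    assume t: "t \<in> {0..tmax}" and disc: "discretization xmin xmax tmax imax kmax dx dt"
      and cfl: "CFL \<xi> c dx dt" and small: "sqrt (dx\<^sup>2 + dt\<^sup>2) < \<alpha>"
      and sol: "discrete_solution c imax kmax dx dt
        (\<lambda>i. p0 (grid_x xmin dx i)) (\<lambda>i. p1 (grid_x xmin dx i)) (\<lambda>k i. 0) ph"
    obtain m where m: "imax = Suc m"
      using disc by (cases imax) (auto simp: discretization_def)
    have dx: "0 < dx" "real (Suc m) * dx = xmax - xmin"
      using disc assms(3) by (simp_all add: discretization_def m del: of_nat_Suc)
    have dt: "0 < dt" "real kmax * dt = tmax"
      using disc assms(5) by (auto simp: discretization_def)
    have dx_dt_less: "dx < \<alpha>" "dt < \<alpha>"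
      using small real_sqrt_sum_squares_ge1[of dx dt] real_sqrt_sum_squares_ge2[of dt dx] by linarith+
    define h where "h = dx\<^sup>2 + dt\<^sup>2"
    have "0 \<le> h" by (simp add: h_def)
    define e where "e = convergence_error xmin dx dt p ph"
    define r where "r = c * dt / dx"
    \<comment> \<open>The source is defined as the defect of \<open>e\<close> in the scheme, so the
      recurrence holds trivially and consistency only has to bound \<open>g\<close>. It is used for
      \<open>k > 0\<close> only, where \<open>k - 1\<close> does not truncate.\<close>
    define g where "g k i = e (k + 1) i - 2 * e k i + e (k - 1) i
        - r\<^sup>2 * (e k (i + 1) - 2 * e k i + e k (i - 1))" for k i
    have e: "e k i = p (grid_x xmin dx i, grid_t dt k) - ph k i" for k i
      by (simp add: e_def convergence_error_def)
    have x_in: "grid_x xmin dx i \<in> {xmin..xmax}" if "i \<le> Suc m" for i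
    proof -
      have "real i * dx \<le> real (Suc m) * dx" using that dx by (intro mult_right_mono) auto
      then show ?thesis using dx(1) unfolding dx(2) by (simp add: grid_x_def)
    qed
    have t_in: "grid_t dt k \<in> {0..tmax}" if "k \<le> kmax" for k
      using that dt by (auto simp: grid_t_def simp flip: dt(2))
    have x_shift: "grid_x xmin dx (i + 1) = grid_x xmin dx i + dx"
      "grid_x xmin dx (i - 1) = grid_x xmin dx i - dx" if "i \<in> {1..m}" for i
      using that by (auto simp: grid_x_def algebra_simps of_nat_diff)
    have t_shift: "grid_t dt (k + 1) = grid_t dt k + dt"
      "0 < k \<Longrightarrow> grid_t dt (k - 1) = grid_t dt k - dt" for k
      by (auto simp: grid_t_def algebra_simps of_nat_diff)
    have bdry: "e k 0 = 0 \<and> e k (Suc m) = 0" if "k \<le> kmax" for k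
      using that sol p_bdry[of "grid_t dt k"] t_in[OF that] dx
      by (auto simp: e discrete_solution_def m grid_x_def)
    have init: "e 0 i = 0" if "i \<le> Suc m" for i
    proof (cases "i \<in> {1..m}")
      case True
      then show ?thesis using sol p_init[OF x_in[OF that]]
        by (simp add: e discrete_solution_def m grid_t_def)
    next
      \<comment> \<open>The scheme prescribes initial values at inner nodes only; at the two ends
        the boundary condition takes over.\<close>
      case False
      then have "i = 0 \<or> i = Suc m" using that by auto
      then show ?thesis using bdry[of 0] by auto
    qed
    have first: "\<bar>e 1 i\<bar> \<le> dt * (M * h)" if i: "i \<in> {1..m}" for i
    proof -
      let ?x = "grid_x xmin dx i"
      let ?R = "(p (?x, dt) - p (?x, 0)) / dt
        - dt / 2 * (c\<^sup>2 * ((p (?x + dx, 0) - 2 * p (?x, 0) + p (?x - dx, 0)) / dx\<^sup>2)) - p1 ?x"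
      \<comment> \<open>As the initial error is zero, \<open>A_h\<close> acts equally on the
        discrete and the exact initial values, and only the time difference contributes to
        \<open>e 1 i\<close>.\<close>
      have ph0: "ph 0 j = p (grid_x xmin dx j, 0)" if "j \<le> Suc m" for j
        using init[OF that] by (simp add: e grid_t_def)
      have "(ph 1 i - ph 0 i) / dt + dt / 2 * A_h c dx (ph 0) i = p1 ?x"
        using sol i unfolding discrete_solution_def m diff_Suc_1 by blast
      moreover have "i - 1 \<le> Suc m" using i by auto
      with i have "A_h c dx (ph 0) i
          = - (c\<^sup>2 * ((p (?x + dx, 0) - 2 * p (?x, 0) + p (?x - dx, 0)) / dx\<^sup>2))"
        using ph0[of i] ph0[of "i + 1"] ph0[of "i - 1"] x_shift[OF i] by (simp add: A_h_def)
      ultimately have "?R = (p (?x, dt) - p (?x, 0)) / dt - (ph 1 i - ph 0 i) / dt" by simp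
      also have "\<dots> = e 1 i / dt"
        using ph0[of i] i by (simp add: e grid_t_def diff_divide_distrib)
      finally have "e 1 i = dt * ?R" using dt by simp
      then have "\<bar>e 1 i\<bar> = dt * \<bar>?R\<bar>" using dt by (simp only: abs_mult abs_of_pos)
      also have "\<dots> \<le> dt * (M * h)"
        unfolding h_def using i dt by (intro mult_left_mono trunc1 x_in dx dx_dt_less) auto
      finally show ?thesis .
    qed
    have source: "\<bar>g k i\<bar> \<le> dt\<^sup>2 * (M * h)" if k: "0 < k" "k < kmax" and i: "i \<in> {1..m}" for k i
    proof -
      let ?x = "grid_x xmin dx i" and ?t = "grid_t dt k"
      let ?R = "(p (?x, ?t + dt) - 2 * p (?x, ?t) + p (?x, ?t - dt)) / dt\<^sup>2
        - c\<^sup>2 * ((p (?x + dx, ?t) - 2 * p (?x, ?t) + p (?x - dx, ?t)) / dx\<^sup>2)"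
      let ?P = "(ph (k + 1) i - 2 * ph k i + ph (k - 1) i) / dt\<^sup>2
        - c\<^sup>2 * ((ph k (i + 1) - 2 * ph k i + ph k (i - 1)) / dx\<^sup>2)"
      have "\<forall>k\<in>{2..kmax}. (ph k i - 2 * ph (k - 1) i + ph (k - 2) i) / dt\<^sup>2 + A_h c dx (ph (k - 1)) i = 0"
        using sol i by (simp add: discrete_solution_def m)
      then have "?P = 0"
        using k by (elim ballE[of _ _ "k + 1"]) (auto simp: A_h_def numeral_2_eq_2)
      \<comment> \<open>Passes between the undivided form and the divided scheme, using that
        \<open>r / dt\<close> equals \<open>c / dx\<close>.\<close>
      have scale: "a - r\<^sup>2 * b = dt\<^sup>2 * (a / dt\<^sup>2 - c\<^sup>2 * (b / dx\<^sup>2))" for a b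
        using dt(1) dx(1) by (simp add: r_def field_simps)
      have "g k i = ((p (?x, ?t + dt) - 2 * p (?x, ?t) + p (?x, ?t - dt))
          - r\<^sup>2 * (p (?x + dx, ?t) - 2 * p (?x, ?t) + p (?x - dx, ?t)))
        - ((ph (k + 1) i - 2 * ph k i + ph (k - 1) i)
          - r\<^sup>2 * (ph k (i + 1) - 2 * ph k i + ph k (i - 1)))"
        unfolding g_def e t_shift(1) t_shift(2)[OF k(1)] x_shift[OF i]
        by (simp only: algebra_simps)
      then have "g k i = dt\<^sup>2 * ?R"
        unfolding scale \<open>?P = 0\<close> by simp
      then have "\<bar>g k i\<bar> = dt\<^sup>2 * \<bar>?R\<bar>"
        by (simp only: abs_mult abs_power2)
      also have "\<dots> \<le> dt\<^sup>2 * (M * h)"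
        unfolding h_def using i k by (intro mult_left_mono trunc x_in t_in dx dt dx_dt_less) auto
      finally show ?thesis .
    qed
    define k where "k = time_index dt t"
    have "t / dt \<le> real kmax" using t dt by (simp add: divide_le_eq)
    then have k: "k \<le> kmax" unfolding k_def time_index_def
      by (simp add: nat_le_iff) linarith
    have "0 \<le> r" "r \<le> 1 - \<xi>"
      using cfl assms(4) dx dt by (auto simp: r_def CFL_def)
    then have "r\<^sup>2 \<le> (1 - \<xi>)\<^sup>2" by (intro power_mono)
    then have "\<delta>\<^sup>2 \<le> 1 - r\<^sup>2" using \<delta> by simp
    let ?N = "sqrt (real (Suc m))"
    have "L2_set (e k) {1..m}
        \<le> real k * ((?N * (dt * (M * h)) + real kmax * (?N * (dt\<^sup>2 * (M * h)) / \<delta>)) / \<delta>)"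
    proof (rule wave_scheme_stable[where g = g and r = r])
      show "e (k + 2) i - 2 * e (k + 1) i + e k i
        = r\<^sup>2 * (e (k + 1) (i + 1) - 2 * e (k + 1) i + e (k + 1) (i - 1)) + g (k + 1) i" for k i
        by (simp add: g_def)
      show "L2_set (e 1) {1..m} \<le> ?N * (dt * (M * h))"
        using first pos dt \<open>0 \<le> h\<close> by (intro L2_set_le_const) auto
      show "L2_set (g k) {1..m} \<le> ?N * (dt\<^sup>2 * (M * h))" if "0 < k" "k < kmax" for k
        using source that pos dt \<open>0 \<le> h\<close> by (intro L2_set_le_const) auto
    qed (use bdry init k \<delta> pos dt \<open>0 \<le> h\<close> \<open>\<delta>\<^sup>2 \<le> 1 - r\<^sup>2\<close> in auto)
    also have "\<dots> \<le> real kmax * ((?N * (dt * (M * h)) + real kmax * (?N * (dt\<^sup>2 * (M * h)) / \<delta>)) / \<delta>)"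
      using k pos dt \<delta> \<open>0 \<le> h\<close> by (intro mult_right_mono) auto
    \<comment> \<open>Every factor \<open>kmax\<close> meets one factor \<open>dt\<close>: one pair
      in the first-step term, two in the source term. Only \<open>tmax\<close> remains.\<close>
    also have "\<dots> = ?N * ((real kmax * dt) * M + (real kmax * dt) * ((real kmax * dt) * M / \<delta>)) / \<delta> * h"
      using \<delta>(1) by (simp add: field_simps power2_eq_square)
    also have "\<dots> = ?N * (tmax * M + tmax * (tmax * M / \<delta>)) / \<delta> * h"
      by (simp only: dt(2))
    finally have bound: "L2_set (e k) {1..m} \<le> ?N * (tmax * M + tmax * (tmax * M / \<delta>)) / \<delta> * h" .
    have "dx_norm imax dx (e k) = sqrt dx * L2_set (e k) {1..m}"
      by (simp add: dx_norm_def m L2_set_def mult.commute sum_distrib_left flip: real_sqrt_mult)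
    also have "\<dots> \<le> sqrt dx * (?N * (tmax * M + tmax * (tmax * M / \<delta>)) / \<delta> * h)"
      using bound dx by (intro mult_left_mono) auto
    also have "\<dots> = (?N * sqrt dx) * (tmax * M + tmax * (tmax * M / \<delta>)) / \<delta> * h"
      by (simp add: mult_ac)
    \<comment> \<open>The weight of the discrete norm absorbs the number of cells, which removes the
      last dependence of the constant on the grid.\<close>
    also have "?N * sqrt dx = sqrt (xmax - xmin)"
      by (simp only: dx(2) flip: real_sqrt_mult)
    finally show "dx_norm imax dx (convergence_error xmin dx dt p ph (time_index dt t))
        \<le> C * (dx\<^sup>2 + dt\<^sup>2)"
      by (simp only: C_def h_def e_def k_def)
  qed
qed

end
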